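(* Let $[t_0,t_1]\subset\mathbb R$ be a compact interval, fix $\Lambda>0$ such that $[t_0,t_1]\subset[-\Lambda,\Lambda]$, let $L>\Lambda$ and $K\in\mathbb N$. Assume that $C_\theta$ is the restriction to $[t_0,t_1]^2$ of a real stationary covariance function on $\mathbb R$ with spectral density $S_\theta$. Assume that $S_\theta$ is uniformly bounded on $(0,\infty)$, is differentiable with bounded derivative on $(0,\infty)$, and that both $S_\theta$ and its derivative are integrable on $(0,\infty)$. Let $$\widetilde C_{\theta,L,K}(s,t)=\sum_{k=1}^K S_\theta\left(\frac{k\pi}{2L}\right)\phi_{k,L}(s)\phi_{k,L}(t),\qquad \phi_{k,L}(t)=L^{-1/2}\sin\left(\frac{k\pi(t+L)}{2L}\right).$$ Then there exists a constant $E<\infty$, depending at most on $S_\theta$ and $\Lambda$ but independent of $K,L,s,t$, such that $$\sup_{(s,t)\in[t_0,t_1]^2}\left|C_\theta(s,t)-\widetilde C_{\theta,L,K}(s,t)\right|\le\frac EL+\frac1\pi\int_{\pi K/(2L)}^\infty S_\theta(\omega)\,d\omega.$$ Moreover, let $(a,b)\in\mathbb N_0^2$ be fixed such that $S_\theta^{[a,b]}(\omega):=\omega^{a+b}S_\theta(\omega)$, $\omega>0$, is uniformly bounded on $(0,\infty)$, is differentiable with bounded derivative on $(0,\infty)$, and both $S_\theta^{[a,b]}$ and its derivative are integrable on $(0,\infty)$. Then there exists a constant $E_{a,b}<\infty$, depending at most on $S_\theta$, $(a,b)$ and $\Lambda$ but independent of $K,L,s,t$, such that $$\sup_{(s,t)\in[t_0,t_1]^2}\left|D_1^aD_2^bC_\theta(s,t)-D_1^aD_2^b\widetilde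 C_{\theta,L,K}(s,t)\right|\le\frac{E_{a,b}}{L}+\frac1\pi\int_{\pi K/(2L)}^\infty\omega^{a+b}S_\theta(\omega)\,d\omega.$$ Consequently, as $K,L\to\infty$ with $K/L\to\infty$, $\widetilde C_{\theta,L,K}\to C_\theta$ uniformly on $[t_0,t_1]^2$, and for the same fixed pair $(a,b)$, $D_1^aD_2^b\widetilde C_{\theta,L,K}\to D_1^aD_2^bC_\theta$ uniformly on $[t_0,t_1]^2$.
   Context: $D_1,D_2$ differentiate in the first and second argument; $\mathbb N_0=\{0,1,2,\ldots\}$. A stationary covariance function is written $C_\theta(s,t)=C_\theta(\tau)$, $\tau=s-t$. Its spectral density is $S_\theta(\omega)=\int_{-\infty}^\infty C_\theta(\tau)e^{-\mathrm i\omega\tau}\,d\tau$, an even nonnegative function, so that (Fourier inversion) $C_\theta(\tau)=\frac1{2\pi}\int_{\mathbb R}S_\theta(\omega)e^{\mathrm i\omega\tau}\,d\omega$ for all $\tau\in\mathbb R$. *)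

theory Defs
  imports "HOL-Analysis.Analysis"
begin

definition covariance_function :: "(real \<Rightarrow> real \<Rightarrow> real) \<Rightarrow> bool" where
  "covariance_function k \<longleftrightarrow>
     (\<forall>s t. k s t = k t s) \<and>
     (\<forall>T a. finite T \<longrightarrow> 0 \<le> (\<Sum>s\<in>T. \<Sum>t\<in>T. a s * a t * k s t))"

definition stationary_covariance :: "(real \<Rightarrow> real) \<Rightarrow> bool" where
  "stationary_covariance c \<longleftrightarrow> covariance_function (\<lambda>s t. c (s - t))"

text \<open>Inversion is required at every point. It does not follow from the other clauses: changing
  \<open>c\<close> on a null set leaves \<open>S\<close> unchanged.\<close>

definition spectral_density :: "(real \<Rightarrow> real) \<Rightarrow> (real \<Rightarrow> real) \<Rightarrow> bool" where
  "spectral_density c S \<longleftrightarrow>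
     integrable lborel c \<and>
     (\<forall>\<omega>. complex_of_real (S \<omega>) =
        (LINT \<tau>|lborel. complex_of_real (c \<tau>) * exp (- \<i> * complex_of_real (\<omega> * \<tau>)))) \<and>
     (\<forall>\<omega>. S (- \<omega>) = S \<omega>) \<and>
     (\<forall>\<omega>. 0 \<le> S \<omega>) \<and>
     integrable lborel S \<and>
     (\<forall>\<tau>. complex_of_real (c \<tau>) = 1 / (2 * complex_of_real pi) *
        (LINT \<omega>|lborel. complex_of_real (S \<omega>) * exp (\<i> * complex_of_real (\<omega> * \<tau>))))"

definition restricted_stationary_covariance ::
    "(real \<Rightarrow> real) \<Rightarrow> real set \<Rightarrow> (real \<Rightarrow> real \<Rightarrow> real) \<Rightarrow> bool" where
  "restricted_stationary_covariance S T C \<longleftrightarrow>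
     (\<exists>c. stationary_covariance c \<and> spectral_density c S \<and>
          (\<forall>s\<in>T. \<forall>t\<in>T. C s t = c (s - t)))"

definition regular_on_positives :: "(real \<Rightarrow> real) \<Rightarrow> bool" where
  "regular_on_positives f \<longleftrightarrow>
     bounded (f ` {0<..}) \<and>
     (\<forall>\<omega>>0. f differentiable (at \<omega>)) \<and>
     bounded (deriv f ` {0<..}) \<and>
     set_integrable lborel {0<..} f \<and>
     set_integrable lborel {0<..} (deriv f)"

definition basis_fun :: "nat \<Rightarrow> real \<Rightarrow> real \<Rightarrow> real" where
  "basis_fun k L t = L powr (- 1 / 2) * sin (real k * pi * (t + L) / (2 * L))"

definition approx_cov :: "(real \<Rightarrow> real) \<Rightarrow> real \<Rightarrow> nat \<Rightarrow> real \<Rightarrow> real \<Rightarrow> real" where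
  "approx_cov S L K s t =
     (\<Sum>k = 1..K. S (real k * pi / (2 * L)) * basis_fun k L s * basis_fun k L t)"

text \<open>Partial derivatives are taken relative to \<open>T \<times> T\<close>, hence one-sided at the endpoints of an
  interval \<open>T\<close>. Only the values of \<open>f\<close> on \<open>T \<times> T\<close> matter for points of \<open>T \<times> T\<close>.\<close>

definition partial1 :: "real set \<Rightarrow> (real \<Rightarrow> real \<Rightarrow> real) \<Rightarrow> real \<Rightarrow> real \<Rightarrow> real" where
  "partial1 T f = (\<lambda>s t. vector_derivative (\<lambda>x. f x t) (at s within T))"

definition partial2 :: "real set \<Rightarrow> (real \<Rightarrow> real \<Rightarrow> real) \<Rightarrow> real \<Rightarrow> real \<Rightarrow> real" where
  "partial2 T f = (\<lambda>s t. vector_derivative (\<lambda>y. f s y) (at t within T))"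

definition mixed_partial ::
    "real set \<Rightarrow> nat \<Rightarrow> nat \<Rightarrow> (real \<Rightarrow> real \<Rightarrow> real) \<Rightarrow> real \<Rightarrow> real \<Rightarrow> real" where
  "mixed_partial T a b f = (partial1 T ^^ a) ((partial2 T ^^ b) f)"

text \<open>Since \<^const>\<open>vector_derivative\<close> is total, existence of the iterated derivative is a
  separate predicate.\<close>

definition mixed_partial_exists ::
    "real set \<Rightarrow> nat \<Rightarrow> nat \<Rightarrow> (real \<Rightarrow> real \<Rightarrow> real) \<Rightarrow> bool" where
  "mixed_partial_exists T a b f \<longleftrightarrow>
     (\<forall>j<b. \<forall>s\<in>T. \<forall>t\<in>T. (\<lambda>y. mixed_partial T 0 j f s y) differentiable (at t within T)) \<and>
     (\<forall>i<a. \<forall>s\<in>T. \<forall>t\<in>T. (\<lambda>x. mixed_partial T i b f x t) differentiable (at s within T))"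

end

theory Submission
  imports Defs
begin

text \<open>
  Put \<open>g(\<omega>) = \<omega>\<^sup>a\<^sup>+\<^sup>b S(\<omega>)\<close> and \<open>h = \<pi>/(2L)\<close>. By \<open>2 sin X sin Y = cos (X - Y) - cos (X + Y)\<close>,
  differentiating the truncated expansion gives
  \<open>1/(2L) \<Sum>\<^sub>k g(kh) (cos(kh(s-t)+p) - (-1)\<^sup>k cos(kh(s+t)+q))\<close>
  with phases \<open>p = (a-b)\<pi>/2\<close> and \<open>q = (a+b)\<pi>/2\<close>; the sign \<open>(-1)\<^sup>k\<close> comes from the shift
  \<open>2khL = k\<pi>\<close>. The first part is a right-endpoint Riemann sum of
  \<open>1/\<pi> \<integral> g(\<omega>) cos(\<omega>(s-t)+p) d\<omega>\<close> over \<open>(0, Kh]\<close>, whose error is at most the mesh times the total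
  variation of the integrand. The second part is an alternating sum, hence bounded by the supremum
  plus the total variation. Both variations are at most \<open>\<integral>|g'| + 2\<Lambda>\<integral>|g|\<close>, and both parts carry a
  factor \<open>1/L\<close>. What remains is the tail of the spectral integral beyond \<open>Kh\<close>.
\<close>

section \<open>Set integrals of real functions\<close>

lemma set_integrable_mult_bounded:
  fixes f h :: "'a \<Rightarrow> real"
  assumes "set_integrable M A f" "h \<in> borel_measurable M" "\<And>x. \<bar>h x\<bar> \<le> B"
  shows "set_integrable M A (\<lambda>x. f x * h x)"
proof -
  have f: "integrable M (\<lambda>x. indicator A x * f x)"
    using assms(1) by (simp add: set_integrable_def)
  have [measurable]: "(\<lambda>x. indicator A x * f x) \<in> borel_measurable M"
    using f by (rule borel_measurable_integrable)
  note assms(2)[measurable]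
  have "integrable M (\<lambda>x. (indicator A x * f x) * h x)"
  proof (rule Bochner_Integration.integrable_bound[OF integrable_mult_left[OF f, of B]])
    show "AE x in M. norm (indicator A x * f x * h x) \<le> norm (indicator A x * f x * B)"
      by (intro AE_I2) (auto simp: abs_mult intro!: mult_left_mono order_trans[OF assms(3)])
  qed measurable
  then show ?thesis
    by (simp add: set_integrable_def mult.assoc)
qed

lemma set_integral_abs_le:
  fixes f :: "'a \<Rightarrow> real"
  shows "\<bar>LINT x:A|M. f x\<bar> \<le> (LINT x:A|M. \<bar>f x\<bar>)"
proof -
  have "\<bar>LINT x:A|M. f x\<bar> \<le> (\<integral>x. \<bar>indicator A x * f x\<bar> \<partial>M)"
    unfolding set_lebesgue_integral_def real_scaleR_def by (rule integral_abs_bound)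
  then show ?thesis
    by (simp add: set_lebesgue_integral_def abs_mult)
qed

lemma set_integral_nonneg_mono_set:
  fixes f :: "'a \<Rightarrow> real"
  assumes "set_integrable M B f" "A \<in> sets M" "A \<subseteq> B" "\<And>x. x \<in> B \<Longrightarrow> 0 \<le> f x"
  shows "(LINT x:A|M. f x) \<le> (LINT x:B|M. f x)"
proof -
  have "set_integrable M A f"
    using assms by (intro set_integrable_subset[OF assms(1)]) auto
  then show ?thesis
    using assms unfolding set_integrable_def set_lebesgue_integral_def
    by (intro integral_mono) (auto split: split_indicator)
qed

lemma abs_cos_diff_le: "\<bar>cos x - cos y\<bar> \<le> \<bar>x - y\<bar>" for x y :: real
proof -
  have "\<bar>cos x - cos y\<bar> = 2 * \<bar>sin ((x + y) / 2)\<bar> * \<bar>sin ((y - x) / 2)\<bar>"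
    by (simp add: cos_diff_cos abs_mult)
  also have "\<dots> \<le> 2 * 1 * \<bar>(y - x) / 2\<bar>"
    by (intro mult_mono abs_sin_x_le_abs_x) auto
  finally show ?thesis by simp
qed

section \<open>Riemann sums and alternating sums via total variation\<close>

text \<open>The fundamental theorem of calculus on \<open>{x..y}\<close> writes the increment as an
  integral of \<open>D\<close>. The cell is open on the left, which keeps \<open>{x..y}\<close>
  inside the open half-line even for the first cell \<open>u = 0\<close>, where no derivative is
  given.\<close>

lemma diff_le_variation_integral:
  fixes G D :: "real \<Rightarrow> real"
  assumes G: "\<And>x. x > 0 \<Longrightarrow> (G has_real_derivative D x) (at x)"
    and D: "set_integrable lborel {0<..} D"
    and u: "0 \<le> u" and xy: "x \<in> {u<..v}" "y \<in> {u<..v}"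
  shows "\<bar>G x - G y\<bar> \<le> (LINT w:{u<..v}|lborel. \<bar>D w\<bar>)"
proof -
  have *: "\<bar>G y - G x\<bar> \<le> (LINT w:{u<..v}|lborel. \<bar>D w\<bar>)"
    if "x \<le> y" "x \<in> {u<..v}" "y \<in> {u<..v}" for x y
  proof -
    have Dxy: "set_integrable lborel {x..y} D"
      using u that by (intro set_integrable_subset[OF D]) auto
    have "(D has_integral (G y - G x)) {x..y}"
      using u that
      by (intro fundamental_theorem_of_calculus)
         (auto simp: has_real_derivative_iff_has_vector_derivative[symmetric]
           intro!: has_field_derivative_at_within G)
    then have "G y - G x = (LINT w:{x..y}|lborel. D w)"
      using set_borel_integral_eq_integral(2)[OF Dxy] by (simp add: integral_unique)
    also have "\<bar>\<dots>\<bar> \<le> (LINT w:{x..y}|lborel. \<bar>D w\<bar>)"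
      by (rule set_integral_abs_le)
    also have "\<dots> \<le> (LINT w:{u<..v}|lborel. \<bar>D w\<bar>)"
      using u that by (intro set_integral_nonneg_mono_set set_integrable_abs
          set_integrable_subset[OF D]) auto
    finally show ?thesis .
  qed
  show ?thesis
    using *[of x y] *[of y x] xy by (cases "x \<le> y") (auto simp: abs_minus_commute)
qed

text \<open>With \<open>(v - u) * G v\<close> read as the integral of a constant, the error becomes
  the integral of \<open>G w - G v\<close>. Its integrand is at most the variation over the cell,
  and integrating that bound gives the factor \<open>v - u\<close>.\<close>

lemma right_endpoint_error:
  fixes G D :: "real \<Rightarrow> real"
  assumes G: "\<And>x. x > 0 \<Longrightarrow> (G has_real_derivative D x) (at x)"
    and D: "set_integrable lborel {0<..} D" and GI: "set_integrable lborel {0<..} G"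
    and u: "0 \<le> u" "u < v"
  shows "\<bar>(LINT w:{u<..v}|lborel. G w) - (v - u) * G v\<bar>
    \<le> (v - u) * (LINT w:{u<..v}|lborel. \<bar>D w\<bar>)"
proof -
  let ?V = "LINT w:{u<..v}|lborel. \<bar>D w\<bar>"
  have c: "set_integrable lborel {u<..v} (\<lambda>_. c)" for c :: real
    using u by (simp add: set_integrable_def)
  have cI: "(LINT w:{u<..v}|lborel. c) = (v - u) * c" for c :: real
    using u by (simp add: set_lebesgue_integral_def)
  have GI': "set_integrable lborel {u<..v} G"
    using u by (intro set_integrable_subset[OF GI]) auto
  have "(LINT w:{u<..v}|lborel. G w) - (v - u) * G v = (LINT w:{u<..v}|lborel. G w - G v)"
    using GI' c by (simp add: set_integral_diff cI)
  also have "\<bar>\<dots>\<bar> \<le> (LINT w:{u<..v}|lborel. \<bar>G w - G v\<bar>)"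
    by (rule set_integral_abs_le)
  also have "\<dots> \<le> (LINT w:{u<..v}|lborel. ?V)"
    using GI' c u diff_le_variation_integral[OF G D u(1)]
    by (intro set_integral_mono set_integrable_abs set_integral_diff) auto
  finally show ?thesis by (simp add: cI)
qed

lemma set_integral_split_Ioc:
  fixes f :: "real \<Rightarrow> real"
  assumes "set_integrable lborel {0<..} f" "0 \<le> u" "u \<le> v" "v \<le> z"
  shows "(LINT w:{u<..z}|lborel. f w) = (LINT w:{u<..v}|lborel. f w) + (LINT w:{v<..z}|lborel. f w)"
proof -
  have "{u<..z} = {u<..v} \<union> {v<..z}"
    using assms by auto
  then show ?thesis
    using assms
    by (simp only:) (intro set_integral_Un set_integrable_subset[OF assms(1)], auto)
qed

lemma set_integral_step:
  fixes f :: "real \<Rightarrow> real"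
  assumes "set_integrable lborel {0<..} f" "h > 0"
  shows "(LINT w:{0<..real (Suc n) * h}|lborel. f w)
    = (LINT w:{0<..real n * h}|lborel. f w) + (LINT w:{real n * h<..real (Suc n) * h}|lborel. f w)"
  using assms by (intro set_integral_split_Ioc) auto

text \<open>Each induction step adds one cell of width \<open>h\<close>. The cells are disjoint, so
  their variations add up to the variation over the whole range and only a single factor
  \<open>h\<close> remains, however large \<open>n\<close> is.\<close>

lemma riemann_sum_error:
  fixes G D :: "real \<Rightarrow> real"
  assumes G: "\<And>x. x > 0 \<Longrightarrow> (G has_real_derivative D x) (at x)"
    and D: "set_integrable lborel {0<..} D" and GI: "set_integrable lborel {0<..} G"
    and h: "h > 0"
  shows "\<bar>(LINT w:{0<..real n * h}|lborel. G w) - h * (\<Sum>k = 1..n. G (real k * h))\<bar>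
    \<le> h * (LINT w:{0<..real n * h}|lborel. \<bar>D w\<bar>)"
proof (induction n)
  case (Suc n)
  have "\<bar>(LINT w:{real n * h<..real (Suc n) * h}|lborel. G w) - h * G (real (Suc n) * h)\<bar>
    \<le> h * (LINT w:{real n * h<..real (Suc n) * h}|lborel. \<bar>D w\<bar>)"
    using right_endpoint_error[OF G D GI, of "real n * h" "real (Suc n) * h"] h
    by (simp add: algebra_simps)
  with Suc show ?case
    unfolding set_integral_step[OF GI h] set_integral_step[OF set_integrable_abs[OF D] h]
    by (simp add: algebra_simps abs_le_iff)
qed (simp add: set_lebesgue_integral_def)

text \<open>In a two-step induction each further pair of neighbouring terms is, up to sign, an
  increment of \<open>G\<close> and is paid for by variation. The term \<open>B\<close> covers the
  unpaired first term that is left when \<open>n\<close> is odd.\<close>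

lemma alternating_sum_bound:
  fixes G D :: "real \<Rightarrow> real"
  assumes G: "\<And>x. x > 0 \<Longrightarrow> (G has_real_derivative D x) (at x)"
    and D: "set_integrable lborel {0<..} D"
    and B: "\<And>x. x > 0 \<Longrightarrow> \<bar>G x\<bar> \<le> B" and h: "h > 0"
  shows "\<bar>\<Sum>k = 1..n. (-1) ^ k * G (real k * h)\<bar> \<le> B + (LINT w:{0<..real n * h}|lborel. \<bar>D w\<bar>)"
proof (induction n rule: induct_nat_012)
  case 0
  \<comment> \<open>The empty sum requires \<open>0 \<le> B\<close>, which the bound at the sample
    point \<open>1\<close> supplies.\<close>
  then show ?case
    using B[of 1] by (simp add: set_lebesgue_integral_def)
next
  case 1
  have "0 \<le> (LINT w:{0<..h}|lborel. \<bar>D w\<bar>)"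
    by (auto simp: set_lebesgue_integral_def intro!: integral_nonneg_AE)
  then show ?case
    using B[OF h] by simp
next
  case (ge2 n)
  let ?a = "real (Suc n) * h" and ?b = "real (Suc (Suc n)) * h"
  note st = set_integral_step[OF set_integrable_abs[OF D] h]
  let ?I = "(LINT w:{real n * h<..?a}|lborel. \<bar>D w\<bar>) + (LINT w:{?a<..?b}|lborel. \<bar>D w\<bar>)"
  have "(LINT w:{real n * h<..?b}|lborel. \<bar>D w\<bar>) = ?I"
    using h by (intro set_integral_split_Ioc set_integrable_abs[OF D]) auto
  \<comment> \<open>The point \<open>?a\<close> is not in \<open>{?a<..?b}\<close>, so the interval
    reaches back by one more cell. Intervals belonging to different pairs are still
    disjoint.\<close>
  moreover have "\<bar>G ?b - G ?a\<bar> \<le> (LINT w:{real n * h<..?b}|lborel. \<bar>D w\<bar>)"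
    using h by (intro diff_le_variation_integral[OF G D]) auto
  moreover have "(\<Sum>k = 1..Suc (Suc n). (-1) ^ k * G (real k * h))
      = (\<Sum>k = 1..n. (-1) ^ k * G (real k * h)) + (-1) ^ n * (G ?b - G ?a)"
    by (simp add: algebra_simps)
  moreover have "\<bar>(-1) ^ n * (G ?b - G ?a)\<bar> = \<bar>G ?b - G ?a\<bar>"
    by (simp add: abs_mult power_abs)
  ultimately show ?case
    using ge2(1) unfolding st by linarith
qed

section \<open>Cosine transforms: differentiation, integrability of weights, Fourier
  inversion\<close>

text \<open>Dominated convergence for the difference quotients along an arbitrary sequence: cosine
  is 1-Lipschitz, so \<open>\<bar>w * f w\<bar>\<close> is a majorant on the half-line. Writing
  \<open>- sin z\<close> as \<open>cos (z + pi / 2)\<close> keeps the derivative in the same shape,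
  so the rule can be iterated.\<close>

lemma has_real_derivative_cos_transform:
  fixes f :: "real \<Rightarrow> real"
  assumes f: "set_integrable lborel {0<..} f"
    and wf: "set_integrable lborel {0<..} (\<lambda>w. w * f w)"
  shows "((\<lambda>x. LINT w:{0<..}|lborel. f w * cos (w * x + p)) has_real_derivative
    (LINT w:{0<..}|lborel. (w * f w) * cos (w * x + (p + pi / 2)))) (at x)"
  unfolding has_field_derivative_iff tendsto_at_iff_sequentially
proof (intro allI impI)
  fix X :: "nat \<Rightarrow> real"
  assume X: "\<forall>i. X i \<in> UNIV - {x}" and lim: "X \<longlonglongrightarrow> x"
  let ?F = "\<lambda>x. LINT w:{0<..}|lborel. f w * cos (w * x + p)"
  let ?I = "indicator {0<..} :: real \<Rightarrow> real"
  have i1: "integrable lborel (\<lambda>w. ?I w * f w)" and i2: "integrable lborel (\<lambda>w. ?I w * (w * f w))"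
    using f wf by (auto simp: set_integrable_def)
  note [measurable] = borel_measurable_integrable[OF i1] borel_measurable_integrable[OF i2]
  have I: "set_integrable lborel {0<..} (\<lambda>w. f w * cos (w * y + p))" for y
    by (rule set_integrable_mult_bounded[OF f, of _ 1]) auto
  let ?q = "\<lambda>n w. (?I w * f w) * ((cos (w * X n + p) - cos (w * x + p)) / (X n - x))"
  have "?F y - ?F x = (LINT w:{0<..}|lborel. f w * cos (w * y + p) - f w * cos (w * x + p))" for y
    using I by (simp add: set_integral_diff)
  then have q: "(?F (X n) - ?F x) / (X n - x) = (\<integral>w. ?q n w \<partial>lborel)" for n
    by (simp add: set_lebesgue_integral_def right_diff_distrib diff_divide_distrib mult.assoc
      flip: integral_divide_zero)
  have "(\<lambda>n. \<integral>w. ?q n w \<partial>lborel) \<longlonglongrightarrow>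
    (\<integral>w. (?I w * (w * f w)) * cos (w * x + (p + pi / 2)) \<partial>lborel)"
  proof (rule integral_dominated_convergence[where w = "\<lambda>w. \<bar>?I w * (w * f w)\<bar>"])
    show "AE w in lborel. (\<lambda>n. ?q n w) \<longlonglongrightarrow> (?I w * (w * f w)) * cos (w * x + (p + pi / 2))"
    proof (intro AE_I2)
      fix w
      have "((\<lambda>x. cos (w * x + p)) has_real_derivative (w * cos (w * x + (p + pi / 2)))) (at x)"
        by (auto intro!: derivative_eq_intros simp: cos_add sin_add algebra_simps)
      then have "(\<lambda>n. (cos (w * X n + p) - cos (w * x + p)) / (X n - x))
          \<longlonglongrightarrow> w * cos (w * x + (p + pi / 2))"
        using X lim unfolding has_field_derivative_iff tendsto_at_iff_sequentially
        by (auto simp: o_def)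
      from tendsto_mult_left[OF this, of "?I w * f w"]
      show "(\<lambda>n. ?q n w) \<longlonglongrightarrow> (?I w * (w * f w)) * cos (w * x + (p + pi / 2))"
        by (simp add: algebra_simps)
    qed
    show "AE w in lborel. norm (?q n w) \<le> \<bar>?I w * (w * f w)\<bar>" for n
    proof (intro AE_I2)
      fix w
      have "\<bar>cos (w * X n + p) - cos (w * x + p)\<bar> \<le> \<bar>w\<bar> * \<bar>X n - x\<bar>"
        using abs_cos_diff_le[of "w * X n + p" "w * x + p"]
        by (simp add: abs_mult flip: right_diff_distrib)
      moreover have "X n \<noteq> x" using X by auto
      ultimately have "\<bar>(cos (w * X n + p) - cos (w * x + p)) / (X n - x)\<bar> \<le> \<bar>w\<bar>"
        by (simp add: field_simps)
      then have "\<bar>?I w * f w\<bar> * \<bar>(cos (w * X n + p) - cos (w * x + p)) / (X n - x)\<bar> \<le> \<bar>?I w * f w\<bar> * \<bar>w\<bar>"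
        by (intro mult_left_mono) auto
      then show "norm (?q n w) \<le> \<bar>?I w * (w * f w)\<bar>"
        by (simp only: real_norm_def abs_mult) (simp add: algebra_simps)
    qed
    have "?q n \<in> borel_measurable lborel" for n
      by (intro borel_measurable_times borel_measurable_integrable[OF i1]) measurable
    then show "?q n \<in> borel_measurable lborel" for n .
    show "(\<lambda>w. (?I w * (w * f w)) * cos (w * x + (p + pi / 2))) \<in> borel_measurable lborel"
      by (intro borel_measurable_times borel_measurable_integrable[OF i2]) measurable
  qed (rule integrable_abs[OF i2])
  then show "((\<lambda>y. (?F y - ?F x) / (y - x)) \<circ> X) \<longlonglongrightarrow>
      (LINT w:{0<..}|lborel. (w * f w) * cos (w * x + (p + pi / 2)))"
    unfolding o_def q by (simp add: set_lebesgue_integral_def mult.assoc)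
qed

text \<open>For \<open>w > 0\<close> and \<open>n \<le> m\<close> one has
  \<open>w ^ n \<le> 1 + w ^ m\<close>, so the two given integrands dominate the one in between.
  This provides the weights of the lower derivatives from \<open>S\<close> and the top
  weight.\<close>

lemma set_integrable_intermediate_power:
  fixes f :: "real \<Rightarrow> real"
  assumes f: "set_integrable lborel {0<..} f" and m: "set_integrable lborel {0<..} (\<lambda>w. w ^ m * f w)"
    and "n \<le> m"
  shows "set_integrable lborel {0<..} (\<lambda>w. w ^ n * f w)"
proof -
  let ?I = "indicator {0<..} :: real \<Rightarrow> real"
  have i: "integrable lborel (\<lambda>w. ?I w * f w)" "integrable lborel (\<lambda>w. ?I w * (w ^ m * f w))"
    using f m by (auto simp: set_integrable_def)
  have [measurable]: "(\<lambda>w. ?I w * f w) \<in> borel_measurable lborel"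
    using i(1) by (rule borel_measurable_integrable)
  have "integrable lborel (\<lambda>w. w ^ n * (?I w * f w))"
  proof (rule Bochner_Integration.integrable_bound[OF
      Bochner_Integration.integrable_add[OF integrable_abs[OF i(1)] integrable_abs[OF i(2)]]])
    show "AE w in lborel. norm (w ^ n * (?I w * f w))
        \<le> norm (\<bar>?I w * f w\<bar> + \<bar>?I w * (w ^ m * f w)\<bar>)"
    proof (intro AE_I2)
      fix w :: real
      have "w ^ n \<le> 1 + w ^ m" if "w > 0"
      proof (cases "w \<le> 1")
        case True
        then show ?thesis
          using that power_le_one[of w n] zero_le_power[of w m] by linarith
      next
        case False
        then show ?thesis
          using power_increasing[OF \<open>n \<le> m\<close>, of w] by linarith
      qed
      then have "w ^ n * \<bar>f w\<bar> \<le> (1 + w ^ m) * \<bar>f w\<bar>" if "w > 0"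
        using that by (intro mult_right_mono) auto
      then show "norm (w ^ n * (?I w * f w)) \<le> norm (\<bar>?I w * f w\<bar> + \<bar>?I w * (w ^ m * f w)\<bar>)"
        by (auto simp: abs_mult algebra_simps split: split_indicator)
    qed
  next
    show "(\<lambda>w. w ^ n * (?I w * f w)) \<in> borel_measurable lborel"
      by (intro borel_measurable_times \<open>(\<lambda>w. ?I w * f w) \<in> borel_measurable lborel\<close>) measurable
  qed
  then show ?thesis
    by (simp add: set_integrable_def mult.left_commute)
qed

text \<open>The real part of the inversion formula has a cosine in place of the exponential. Its
  integrand is even, and folding it onto the positive half-line turns \<open>1 / (2 * pi)\<close>
  into \<open>1 / pi\<close>.\<close>

lemma spectral_density_cos_transform:
  assumes "spectral_density c S"
  shows "c x = 1 / pi * (LINT w:{0<..}|lborel. S w * cos (w * x))"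
proof -
  have S: "integrable lborel S" and even: "\<And>w. S (- w) = S w"
    and inv: "complex_of_real (c x) = 1 / (2 * complex_of_real pi) *
        (LINT w|lborel. complex_of_real (S w) * exp (\<i> * complex_of_real (w * x)))"
    using assms unfolding spectral_density_def by blast+
  note [measurable] = borel_measurable_integrable[OF S]
  let ?G = "\<lambda>w. complex_of_real (S w) * exp (\<i> * complex_of_real (w * x))"
  let ?F = "\<lambda>w. S w * cos (w * x)"
  have "integrable lborel ?G"
    by (rule Bochner_Integration.integrable_bound[OF S]) (auto simp: norm_mult)
  then have "(LINT w|lborel. Re (?G w)) = Re (LINT w|lborel. ?G w)"
    by (rule integral_Re)
  moreover have "Re (?G w) = ?F w" for w
    by (simp add: Re_exp)
  moreover have "c x = 1 / (2 * pi) * Re (LINT w|lborel. ?G w)"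
  proof -
    have "1 / (2 * complex_of_real pi) = complex_of_real (1 / (2 * pi))"
      by simp
    then have "complex_of_real (c x) = complex_of_real (1 / (2 * pi)) * (LINT w|lborel. ?G w)"
      using inv by (simp only:)
    from arg_cong[OF this, of Re] show ?thesis
      by (simp only: Re_complex_of_real times_complex.sel Im_complex_of_real mult_zero_left diff_0_right)
  qed
  ultimately have c: "c x = 1 / (2 * pi) * (LINT w|lborel. ?F w)"
    by (simp only:)
  have F: "integrable lborel ?F"
    by (rule Bochner_Integration.integrable_bound[OF S]) (auto simp: abs_mult mult_left_le)
  have Fs: "set_integrable lborel A ?F" if "A \<in> sets lborel" for A
    using integrable_mult_indicator[OF that F] by (simp add: set_integrable_def)
  \<comment> \<open>The point \<open>0\<close> missing from the union is a null set.\<close>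
  have "(LINT w|lborel. ?F w) = (LINT w:{..<0} \<union> {0<..}|lborel. ?F w)"
    unfolding set_lebesgue_integral_def
    by (rule integral_cong_AE)
       (auto intro!: eventually_mono[OF AE_lborel_singleton[of 0]] split: split_indicator)
  also have "\<dots> = (LINT w:{..<0}|lborel. ?F w) + (LINT w:{0<..}|lborel. ?F w)"
    by (intro set_integral_Un Fs) auto
  \<comment> \<open>Reflection \<open>w \<mapsto> - w\<close>, under which both \<open>S\<close> and
    the cosine are invariant.\<close>
  also have "(LINT w:{..<0}|lborel. ?F w) = (LINT w:{0<..}|lborel. ?F w)"
    unfolding set_lebesgue_integral_def
    by (subst lborel_integral_real_affine[of "-1" _ 0])
       (auto intro!: Bochner_Integration.integral_cong simp: even split: split_indicator)
  finally show ?thesis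
    using c by simp
qed

section \<open>Error of the truncated expansion with arbitrary phases\<close>

text \<open>Here \<open>x\<close> and \<open>y\<close> play the roles of \<open>s - t\<close> and
  \<open>s + t\<close>, and free phases \<open>p\<close>, \<open>q\<close> cover all derivative
  orders at once. With \<open>M\<close> a common bound on the variations, the Riemann sum costs
  \<open>M / (2 * L)\<close> and the alternating sum \<open>(B + M) / (2 * L)\<close>; together they
  give \<open>(B / 2 + M) / L\<close>.\<close>

lemma expansion_error:
  fixes g :: "real \<Rightarrow> real" and x y p q R L :: real and K :: nat
  assumes reg: "regular_on_positives g" and B: "\<And>w. w > 0 \<Longrightarrow> \<bar>g w\<bar> \<le> B"
    and pos: "\<And>w. w > 0 \<Longrightarrow> 0 \<le> g w" and L: "L > 0"
    and x: "\<bar>x\<bar> \<le> 2 * R" and y: "\<bar>y\<bar> \<le> 2 * R"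
  defines "h \<equiv> pi / (2 * L)"
  shows "\<bar>1 / pi * (LINT w:{0<..}|lborel. g w * cos (w * x + p))
      - 1 / (2 * L) * (\<Sum>k = 1..K. g (real k * h) *
          (cos (real k * h * x + p) - (-1) ^ k * cos (real k * h * y + q)))\<bar>
    \<le> (B / 2 + (LINT w:{0<..}|lborel. \<bar>deriv g w\<bar>) + 2 * R * (LINT w:{0<..}|lborel. \<bar>g w\<bar>)) / L
      + 1 / pi * (LINT w:{real K * h..}|lborel. g w)"
proof -
  have h: "h > 0" using L by (simp add: h_def)
  have Kh: "0 \<le> real K * h" using h by simp
  have g: "set_integrable lborel {0<..} g" and g': "set_integrable lborel {0<..} (deriv g)"
    and dg: "\<And>w. w > 0 \<Longrightarrow> (g has_real_derivative deriv g w) (at w)"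
    using reg by (auto simp: regular_on_positives_def DERIV_deriv_iff_real_differentiable)
  \<comment> \<open>\<open>D z p\<close> is the derivative of \<open>G z p\<close> in the frequency
    \<open>w\<close>. Both are needed for the two pairs \<open>(x, p)\<close> and
    \<open>(y, q)\<close>.\<close>
  define G where "G z p w = g w * cos (w * z + p)" for z p w
  define D where "D z p w = deriv g w * cos (w * z + p) + g w * (- z * sin (w * z + p))" for z p w
  \<comment> \<open>\<open>M\<close> dominates the variation of \<open>G z p\<close> for every phase
    and every \<open>\<bar>z\<bar> \<le> 2 * R\<close>, because then \<open>\<bar>D z p w\<bar>
    \<le> \<bar>deriv g w\<bar> + 2 * R * \<bar>g w\<bar>\<close>.\<close>
  define M where "M = (LINT w:{0<..}|lborel. \<bar>deriv g w\<bar>) + 2 * R * (LINT w:{0<..}|lborel. \<bar>g w\<bar>)"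
  have dG: "(G z p has_real_derivative D z p w) (at w)" if "w > 0" for z p w
    unfolding G_def D_def using dg[OF that]
    by (auto intro!: derivative_eq_intros simp: algebra_simps)
  have GI: "set_integrable lborel {0<..} (G z p)" for z p
    unfolding G_def by (rule set_integrable_mult_bounded[OF g, of _ 1]) auto
  have DI: "set_integrable lborel {0<..} (D z p)" for z p
    unfolding D_def
    by (intro set_integral_add set_integrable_mult_bounded[OF g', of _ 1]
        set_integrable_mult_bounded[OF g, of _ "\<bar>z\<bar>"])
       (auto simp: abs_mult mult_left_le)
  have GB: "\<bar>G z p w\<bar> \<le> B" if "w > 0" for z p w
    using B[OF that] mult_mono[of "\<bar>g w\<bar>" B "\<bar>cos (w * z + p)\<bar>" 1]
    by (simp add: G_def abs_mult)
  have DM: "(LINT w:{0<..real K * h}|lborel. \<bar>D z p w\<bar>) \<le> M" if "\<bar>z\<bar> \<le> 2 * R" for z p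
  proof -
    have "(LINT w:{0<..real K * h}|lborel. \<bar>D z p w\<bar>) \<le> (LINT w:{0<..}|lborel. \<bar>D z p w\<bar>)"
      by (intro set_integral_nonneg_mono_set set_integrable_abs[OF DI]) auto
    also have "\<dots> \<le> (LINT w:{0<..}|lborel. \<bar>deriv g w\<bar> + 2 * R * \<bar>g w\<bar>)"
    proof (intro set_integral_mono set_integrable_abs[OF DI] set_integral_add
        set_integrable_mult_right set_integrable_abs[OF g] set_integrable_abs[OF g'])
      fix w
      have "\<bar>deriv g w * cos (w * z + p)\<bar> \<le> \<bar>deriv g w\<bar> * 1"
        unfolding abs_mult by (intro mult_left_mono) auto
      moreover have "\<bar>g w * (- z * sin (w * z + p))\<bar> \<le> \<bar>g w\<bar> * (2 * R * 1)"
        unfolding abs_mult using that by (intro mult_left_mono mult_mono) auto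
      ultimately show "\<bar>D z p w\<bar> \<le> \<bar>deriv g w\<bar> + 2 * R * \<bar>g w\<bar>"
        unfolding D_def by (simp add: algebra_simps)
    qed
    also have "\<dots> = M"
      unfolding M_def
      by (subst set_integral_add) (auto intro!: set_integrable_abs g g')
    finally show ?thesis .
  qed
  define T where "T = (LINT w:{real K * h<..}|lborel. G x p w)"
  have sp: "{0<..} = {0<..real K * h} \<union> {real K * h<..}" using Kh by auto
  have tail: "\<bar>T\<bar> \<le> (LINT w:{real K * h..}|lborel. g w)"
  proof -
    have gK: "set_integrable lborel {real K * h<..} g" "set_integrable lborel {real K * h<..} (G x p)"
      using Kh by (auto intro!: set_integrable_subset[OF g] set_integrable_subset[OF GI])
    have "\<bar>T\<bar> \<le> (LINT w:{real K * h<..}|lborel. \<bar>G x p w\<bar>)"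
      unfolding T_def by (rule set_integral_abs_le)
    also have "\<dots> \<le> (LINT w:{real K * h<..}|lborel. g w)"
    proof (intro set_integral_mono set_integrable_abs gK)
      fix w assume "w \<in> {real K * h<..}"
      then have "w > 0" using Kh by auto
      then show "\<bar>G x p w\<bar> \<le> g w"
        using pos[of w] by (simp add: G_def abs_mult mult_left_le)
    qed
    \<comment> \<open>Adding the endpoint changes the domain by a null set only.\<close>
    also have "\<dots> = (LINT w:{real K * h..}|lborel. g w)"
      by (rule set_integral_discrete_difference[where X = "{real K * h}"]) auto
    finally show ?thesis .
  qed
  have "(LINT w:{0<..}|lborel. G x p w) = (LINT w:{0<..real K * h}|lborel. G x p w) + T"
    unfolding T_def
    by (subst sp, intro set_integral_Un set_integrable_subset[OF GI])
       (use Kh in auto)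
  moreover have "\<bar>(LINT w:{0<..real K * h}|lborel. G x p w) - h * (\<Sum>k = 1..K. G x p (real k * h))\<bar> \<le> h * M"
    by (rule order_trans[OF riemann_sum_error[OF dG DI GI h]])
       (use DM[OF x] h in \<open>auto intro!: mult_left_mono\<close>)
  moreover have "\<bar>\<Sum>k = 1..K. (-1) ^ k * G y q (real k * h)\<bar> \<le> B + M"
    by (rule order_trans[OF alternating_sum_bound[OF dG DI GB h]]) (use DM[OF y] in auto)
  moreover define I A1 A2 J where "I = (LINT w:{0<..}|lborel. G x p w)"
    and "A1 = (\<Sum>k = 1..K. G x p (real k * h))" and "A2 = (\<Sum>k = 1..K. (-1) ^ k * G y q (real k * h))"
    and "J = (LINT w:{0<..real K * h}|lborel. G x p w)"
  ultimately have I: "I = J + T" and J: "\<bar>J - h * A1\<bar> \<le> h * M" and A2: "\<bar>A2\<bar> \<le> B + M"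
    by simp_all
  \<comment> \<open>Since \<open>h / pi = 1 / (2 * L)\<close>, the prefactor of the expansion is
    exactly the quadrature weight for \<open>1 / pi\<close> times the integral.\<close>
  have "1 / pi * I - 1 / (2 * L) * (A1 - A2) = (J - h * A1) / pi + A2 / (2 * L) + T / pi"
    using L by (simp add: I h_def diff_divide_distrib add_divide_distrib right_diff_distrib)
  also have "\<bar>\<dots>\<bar> \<le> \<bar>J - h * A1\<bar> / pi + \<bar>A2\<bar> / (2 * L) + \<bar>T\<bar> / pi"
    using L by (intro order_trans[OF abs_triangle_ineq] add_mono) (auto simp: abs_divide)
  also have "\<dots> \<le> h * M / pi + (B + M) / (2 * L) + (LINT w:{real K * h..}|lborel. g w) / pi"
    using L J A2 tail by (intro add_mono divide_right_mono) auto
  also have "\<dots> = (B / 2 + M) / L + 1 / pi * (LINT w:{real K * h..}|lborel. g w)"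
    using L by (simp add: h_def field_simps)
  finally have "\<bar>1 / pi * I - 1 / (2 * L) * (A1 - A2)\<bar>
      \<le> (B / 2 + M) / L + 1 / pi * (LINT w:{real K * h..}|lborel. g w)" .
  moreover have "A1 - A2 = (\<Sum>k = 1..K. g (real k * h) *
      (cos (real k * h * x + p) - (-1) ^ k * cos (real k * h * y + q)))"
    unfolding A1_def A2_def G_def sum_subtractf[symmetric]
    by (intro sum.cong refl) (simp add: right_diff_distrib mult.left_commute)
  moreover have "I = (LINT w:{0<..}|lborel. g w * cos (w * x + p))"
    by (simp add: I_def G_def)
  ultimately show ?thesis
    by (simp only: M_def add.assoc)
qed

section \<open>Iterated partial derivatives relative to a set\<close>

lemma mixed_partial_Suc_left: "mixed_partial T (Suc a) b f = partial1 T (mixed_partial T a b f)"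
  by (simp add: mixed_partial_def)

lemma mixed_partial_0_Suc: "mixed_partial T 0 (Suc b) f = partial2 T (mixed_partial T 0 b f)"
  by (simp add: mixed_partial_def)

lemma mixed_partial_0_0 [simp]: "mixed_partial T 0 0 f = f"
  by (simp add: mixed_partial_def)

text \<open>A family \<open>\<Phi>\<close> of successive derivatives identifies the iterated
  derivative by induction, first over the second argument and then over the first, as in
  \<open>mixed_partial\<close>. Agreement on \<open>T\<close> is enough to transfer each step, as
  derivatives are taken within \<open>T\<close>; \<open>lim\<close> makes them unique.\<close>

lemma
  fixes \<Phi> :: "nat \<Rightarrow> nat \<Rightarrow> real \<Rightarrow> real \<Rightarrow> real"
  assumes lim: "\<And>x. x \<in> T \<Longrightarrow> a + b > 0 \<Longrightarrow> at x within T \<noteq> bot"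
    and f: "\<And>s t. s \<in> T \<Longrightarrow> t \<in> T \<Longrightarrow> f s t = \<Phi> 0 0 s t"
    and dt: "\<And>j s t. j < b \<Longrightarrow> ((\<lambda>y. \<Phi> 0 j s y) has_real_derivative \<Phi> 0 (Suc j) s t) (at t)"
    and ds: "\<And>i s t. i < a \<Longrightarrow> ((\<lambda>x. \<Phi> i b x t) has_real_derivative \<Phi> (Suc i) b s t) (at s)"
  shows mixed_partial_exists_family: "mixed_partial_exists T a b f"
    and mixed_partial_family: "\<And>s t. s \<in> T \<Longrightarrow> t \<in> T \<Longrightarrow> mixed_partial T a b f s t = \<Phi> a b s t"
proof -
  have vt: "((\<lambda>y. F s y) has_vector_derivative \<Phi> 0 (Suc j) s t) (at t within T)"
    if "j < b" "s \<in> T" "t \<in> T" "\<And>s t. s \<in> T \<Longrightarrow> t \<in> T \<Longrightarrow> F s t = \<Phi> 0 j s t" for F j s t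
    using that
    by (intro has_vector_derivative_transform[OF _ _ has_vector_derivative_at_within[OF
        dt[unfolded has_real_derivative_iff_has_vector_derivative]]]) auto
  have vs: "((\<lambda>x. F x t) has_vector_derivative \<Phi> (Suc i) b s t) (at s within T)"
    if "i < a" "s \<in> T" "t \<in> T" "\<And>s t. s \<in> T \<Longrightarrow> t \<in> T \<Longrightarrow> F s t = \<Phi> i b s t" for F i s t
    using that
    by (intro has_vector_derivative_transform[OF _ _ has_vector_derivative_at_within[OF
        ds[unfolded has_real_derivative_iff_has_vector_derivative]]]) auto
  have A: "mixed_partial T 0 j f s t = \<Phi> 0 j s t" if "j \<le> b" "s \<in> T" "t \<in> T" for j s t
    using that
  proof (induction j arbitrary: s t)
    case (Suc j)
    then show ?case
      unfolding mixed_partial_0_Suc partial2_def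
      by (intro vector_derivative_within vt lim) auto
  qed (use f in auto)
  have B: "mixed_partial T i b f s t = \<Phi> i b s t" if "i \<le> a" "s \<in> T" "t \<in> T" for i s t
    using that
  proof (induction i arbitrary: s t)
    case (Suc i)
    then show ?case
      unfolding mixed_partial_Suc_left partial1_def
      by (intro vector_derivative_within vs lim) auto
  qed (use A in auto)
  show "mixed_partial_exists T a b f"
    unfolding mixed_partial_exists_def
    using differentiableI_vector[OF vt[OF _ _ _ A]] differentiableI_vector[OF vs[OF _ _ _ B]]
    by auto
  show "mixed_partial T a b f s t = \<Phi> a b s t" if "s \<in> T" "t \<in> T" for s t
    using B that by simp
qed

text \<open>At the point of a singleton every vector is a derivative, so there \<^const>\<open>vector_derivative\<close>
  is a value that does not depend on the function.\<close>

lemma vector_derivative_singleton: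
  "vector_derivative f (at x within {x}) = vector_derivative g (at x within {x})"
  by (simp add: vector_derivative_def has_vector_derivative_def has_derivative_within_singleton_iff)

text \<open>This handles degenerate intervals. The outermost derivative, in the first argument if
  \<open>a > 0\<close> and in the second otherwise, is already taken within a single point.\<close>

lemma mixed_partial_singleton:
  assumes "a + b > 0"
  shows "mixed_partial {x} a b f x x = mixed_partial {x} a b g x x"
proof (cases a)
  case (Suc i)
  then show ?thesis
    by (simp add: mixed_partial_Suc_left partial1_def)
       (rule vector_derivative_singleton)
next
  case 0
  then obtain j where "b = Suc j" using assms by (cases b) auto
  with 0 show ?thesis
    by (simp add: mixed_partial_0_Suc partial2_def)
       (rule vector_derivative_singleton)
qed

lemma mixed_partial_exists_singleton: "mixed_partial_exists {x} a b f"
proof -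
  have "h differentiable (at x within {x})" for h :: "real \<Rightarrow> real"
    unfolding differentiable_def has_derivative_within_singleton_iff
    using bounded_linear_zero by blast
  then show ?thesis by (simp add: mixed_partial_exists_def)
qed

section \<open>Derivatives of the truncated expansion\<close>

text \<open>Termwise derivatives: each differentiation of a sine contributes a factor
  \<open>w\<close> and a phase \<open>pi / 2\<close>. The factor \<open>1 / L\<close> is the product
  of the two normalisations of the basis functions.\<close>

definition approx_family :: "(real \<Rightarrow> real) \<Rightarrow> real \<Rightarrow> nat \<Rightarrow> nat \<Rightarrow> nat \<Rightarrow> real \<Rightarrow> real \<Rightarrow> real" where
  "approx_family S L K i j s t = (\<Sum>k = 1..K. let w = real k * (pi / (2 * L)) in
     S w / L * w ^ (i + j) * sin (w * (s + L) + real i * pi / 2) * sin (w * (t + L) + real j * pi / 2))"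

lemma approx_cov_eq_family:
  assumes "L > 0"
  shows "approx_cov S L K s t = approx_family S L K 0 0 s t"
proof -
  have "L powr (- 1 / 2) * L powr (- 1 / 2) = 1 / L"
    using assms by (simp add: powr_minus_divide flip: powr_add)
  then have "S w * (L powr (- 1 / 2) * x) * (L powr (- 1 / 2) * y) = S w / L * x * y" for w x y
    by (simp add: algebra_simps)
  then show ?thesis
    by (simp add: approx_cov_def basis_fun_def approx_family_def Let_def)
qed

text \<open>The product-to-sum formula gives the shape treated by \<open>expansion_error\<close>;
  its factor \<open>1 / 2\<close> turns \<open>1 / L\<close> into
  \<open>1 / (2 * L)\<close>.\<close>

lemma approx_family_eq:
  assumes "L > 0"
  shows "approx_family S L K a b s t = 1 / (2 * L) * (\<Sum>k = 1..K.
      (let w = real k * (pi / (2 * L)) in w ^ (a + b) * S w *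
      (cos (w * (s - t) + (real a - real b) * pi / 2)
        - (-1) ^ k * cos (w * (s + t) + (real a + real b) * pi / 2))))"
proof -
  have ss: "sin (w * (s + L) + real a * pi / 2) * sin (w * (t + L) + real b * pi / 2)
      = (cos (w * (s - t) + (real a - real b) * pi / 2)
        - (-1) ^ k * cos (w * (s + t) + (real a + real b) * pi / 2)) / 2"
    if w: "w = real k * (pi / (2 * L))" for w k
  proof -
    \<comment> \<open>The two shifts by \<open>L\<close> cancel in the difference of the arguments
      and add up to \<open>k \<pi>\<close> in their sum, which produces the sign
      \<open>(-1) ^ k\<close>.\<close>
    have wL: "2 * (w * L) = real k * pi"
      using assms by (simp add: w)
    have "cos (w * (s + t) + (real a + real b) * pi / 2 + real k * pi)
        = (-1) ^ k * cos (w * (s + t) + (real a + real b) * pi / 2)"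
      by (simp add: cos_add cos_npi sin_npi)
    moreover have "w * (s + L) + real a * pi / 2 + (w * (t + L) + real b * pi / 2)
        = w * (s + t) + (real a + real b) * pi / 2 + real k * pi"
      using wL by (simp add: field_simps)
    moreover have "w * (s + L) + real a * pi / 2 - (w * (t + L) + real b * pi / 2)
        = w * (s - t) + (real a - real b) * pi / 2"
      by (simp add: field_simps)
    ultimately show ?thesis
      by (simp add: sin_times_sin)
  qed
  then show ?thesis
    unfolding approx_family_def Let_def sum_distrib_left
    by (intro sum.cong refl) (simp only: mult.assoc ss[OF refl], simp add: mult_ac)
qed

lemma has_real_derivative_sin_shift:
  "((\<lambda>x. sin (w * (x + L) + real i * pi / 2)) has_real_derivative
    w * sin (w * (x + L) + real (Suc i) * pi / 2)) (at x)"
proof -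
  have "sin (w * (x + L) + real (Suc i) * pi / 2) = sin (w * (x + L) + real i * pi / 2 + pi / 2)"
    by (simp add: field_simps)
  also have "\<dots> = cos (w * (x + L) + real i * pi / 2)"
    by (subst sin_add) simp
  finally show ?thesis
    by (auto intro!: derivative_eq_intros)
qed

lemma approx_family_deriv1:
  "((\<lambda>x. approx_family S L K i j x t) has_real_derivative approx_family S L K (Suc i) j s t) (at s)"
  unfolding approx_family_def Let_def
  by (rule DERIV_sum, rule DERIV_cong,
      rule DERIV_cmult_right[OF DERIV_cmult[OF has_real_derivative_sin_shift]])
     (simp add: mult_ac)

lemma approx_family_deriv2:
  "((\<lambda>y. approx_family S L K i j s y) has_real_derivative approx_family S L K i (Suc j) s t) (at t)"
  unfolding approx_family_def Let_def
  by (rule DERIV_sum, rule DERIV_cong, rule DERIV_cmult[OF has_real_derivative_sin_shift])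
     (simp add: mult_ac)

section \<open>Derivatives of the spectral integral\<close>

text \<open>A derivative in \<open>s\<close> raises the phase by \<open>pi / 2\<close>; one in
  \<open>t\<close> lowers it by \<open>pi / 2\<close>, because \<open>t\<close> enters with a minus
  sign.\<close>

definition cov_family :: "(real \<Rightarrow> real) \<Rightarrow> nat \<Rightarrow> nat \<Rightarrow> real \<Rightarrow> real \<Rightarrow> real" where
  "cov_family S i j s t =
     1 / pi * (LINT w:{0<..}|lborel. (w ^ (i + j) * S w) * cos (w * (s - t) + (real i - real j) * pi / 2))"

lemma
  assumes S: "set_integrable lborel {0<..} S"
    and m: "set_integrable lborel {0<..} (\<lambda>w. w ^ m * S w)" and ij: "Suc (i + j) \<le> m"
  shows cov_family_deriv1:
      "((\<lambda>x. cov_family S i j x t) has_real_derivative cov_family S (Suc i) j s t) (at s)"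
    and cov_family_deriv2:
      "((\<lambda>y. cov_family S i j s y) has_real_derivative cov_family S i (Suc j) s t) (at t)"
proof -
  let ?p = "(real i - real j) * pi / 2"
  let ?F = "\<lambda>x. LINT w:{0<..}|lborel. (w ^ (i + j) * S w) * cos (w * x + ?p)"
  let ?F' = "\<lambda>x. LINT w:{0<..}|lborel. (w ^ Suc (i + j) * S w) * cos (w * x + (?p + pi / 2))"
  have F: "(?F has_real_derivative ?F' x) (at x)" for x
    using has_real_derivative_cos_transform[of "\<lambda>w. w ^ (i + j) * S w" ?p x]
      set_integrable_intermediate_power[OF S m, of "i + j"]
      set_integrable_intermediate_power[OF S m ij] ij
    by (simp add: mult.assoc)
  have p1: "?p + pi / 2 = (real (Suc i) - real j) * pi / 2"
    and p2: "?p + pi / 2 = (real i - real (Suc j)) * pi / 2 + pi"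
    by (simp_all add: field_simps)
  \<comment> \<open>The phase \<open>?p + pi / 2\<close> exceeds the desired one by
    \<open>\<pi>\<close>; the resulting sign cancels the inner derivative \<open>-1\<close> of
    \<open>s - y\<close>.\<close>
  have c2: "cos (z + (?p + pi / 2)) = - cos (z + (real i - real (Suc j)) * pi / 2)" for z
    unfolding p2 by (simp add: add.assoc[symmetric])
  have "((\<lambda>x. 1 / pi * ?F (x - t)) has_real_derivative 1 / pi * ?F' (s - t)) (at s)"
    by (intro DERIV_cmult) (rule DERIV_cong[OF DERIV_chain2[OF F]], auto intro!: derivative_eq_intros)
  then show "((\<lambda>x. cov_family S i j x t) has_real_derivative cov_family S (Suc i) j s t) (at s)"
    unfolding cov_family_def p1 by simp
  have "((\<lambda>y. 1 / pi * ?F (s - y)) has_real_derivative 1 / pi * - ?F' (s - t)) (at t)"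
    by (intro DERIV_cmult) (rule DERIV_cong[OF DERIV_chain2[OF F]], auto intro!: derivative_eq_intros)
  then show "((\<lambda>y. cov_family S i j s y) has_real_derivative cov_family S i (Suc j) s t) (at t)"
    unfolding cov_family_def c2 by (simp add: set_integral_uminus set_lebesgue_integral_def)
qed

lemma at_within_Icc_neq_bot: "t0 < t1 \<Longrightarrow> x \<in> {t0..t1} \<Longrightarrow> at x within {t0..t1} \<noteq> bot" for x :: real
  using islimpt_Icc[of t0 t1 x] by (simp add: trivial_limit_within)

section \<open>Pointwise error of the mixed partial derivatives\<close>

text \<open>Both iterated derivatives are replaced by their explicit families, to which
  \<open>expansion_error\<close> applies. The constant is built from \<open>R\<close>,
  \<open>B\<close> and integrals of the weighted density and its derivative, so it is common to all
  intervals inside \<open>{-R..R}\<close> and to all \<open>C\<close>, \<open>L\<close> and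
  \<open>K\<close>.\<close>

lemma mixed_partial_error:
  fixes S :: "real \<Rightarrow> real" and R :: real
  defines "E g B \<equiv> B / 2 + (LINT w:{0<..}|lborel. \<bar>deriv g w\<bar>) + 2 * R * (LINT w:{0<..}|lborel. \<bar>g w\<bar>)"
  assumes regS: "regular_on_positives S" and reg: "regular_on_positives (\<lambda>w. w ^ (a + b) * S w)"
    and B: "\<And>w. w > 0 \<Longrightarrow> \<bar>w ^ (a + b) * S w\<bar> \<le> B"
    and R: "R > 0" and t: "t0 \<le> t1" and tR: "{t0..t1} \<subseteq> {-R..R}"
    and C: "restricted_stationary_covariance S {t0..t1} C" and L: "L > 0"
  shows "mixed_partial_exists {t0..t1} a b C" (is ?eC)
    and "mixed_partial_exists {t0..t1} a b (approx_cov S L K)" (is ?eA)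
    and "\<And>s t. s \<in> {t0..t1} \<Longrightarrow> t \<in> {t0..t1} \<Longrightarrow>
      \<bar>mixed_partial {t0..t1} a b C s t - mixed_partial {t0..t1} a b (approx_cov S L K) s t\<bar>
      \<le> E (\<lambda>w. w ^ (a + b) * S w) B / L
        + 1 / pi * (LINT w:{pi * real K / (2 * L)..}|lborel. w ^ (a + b) * S w)"
      (is "\<And>s t. _ \<Longrightarrow> _ \<Longrightarrow> ?err s t \<le> ?bd")
proof -
  let ?g = "\<lambda>w. w ^ (a + b) * S w"
  let ?T = "{t0..t1}"
  obtain c where c: "spectral_density c S" and Cc: "\<And>s t. s \<in> ?T \<Longrightarrow> t \<in> ?T \<Longrightarrow> C s t = c (s - t)"
    using C unfolding restricted_stationary_covariance_def by blast
  have S0: "0 \<le> S w" for w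
    using c unfolding spectral_density_def by blast
  have SI: "set_integrable lborel {0<..} S" and gI: "set_integrable lborel {0<..} ?g"
    using regS reg by (auto simp: regular_on_positives_def)
  have "?eC \<and> ?eA \<and> (\<forall>s\<in>?T. \<forall>t\<in>?T. ?err s t \<le> ?bd)"
  \<comment> \<open>On a one-point interval with a derivative requested, both derivatives take the
    same default value, so the error is \<open>0\<close> and it remains to see that the bound is
    nonnegative. A one-point interval with \<open>a = b = 0\<close> falls under the general
    case.\<close>
  proof (cases "t0 = t1 \<and> a + b > 0")
    case True
    have "0 \<le> B"
      using B[of 1] by linarith
    moreover have "0 \<le> (LINT w:{pi * real K / (2 * L)..}|lborel. ?g w)"
    proof -
      have "0 \<le> w" if "pi * real K / (2 * L) \<le> w" for w
        using L by (intro order_trans[OF _ that]) auto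
      then show ?thesis
        using S0
        by (auto simp: set_lebesgue_integral_def intro!: integral_nonneg_AE AE_I2 split: split_indicator)
    qed
    ultimately have "0 \<le> ?bd"
      using R L
      by (auto simp: E_def set_lebesgue_integral_def intro!: add_nonneg_nonneg divide_nonneg_pos
          mult_nonneg_nonneg integral_nonneg_AE AE_I2 split: split_indicator)
    then show ?thesis
      using True mixed_partial_exists_singleton mixed_partial_singleton[of a b t1 C "approx_cov S L K"]
      by simp
  next
    case False
    then have lim: "at x within ?T \<noteq> bot" if "x \<in> ?T" "a + b > 0" for x
      using that t by (intro at_within_Icc_neq_bot) auto
    have C0: "C s t = cov_family S 0 0 s t" if "s \<in> ?T" "t \<in> ?T" for s t
      using spectral_density_cos_transform[OF c, of "s - t"] Cc[OF that] by (simp add: cov_family_def)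
    have dC: "((\<lambda>y. cov_family S 0 j s y) has_real_derivative cov_family S 0 (Suc j) s t) (at t)" if "j < b" for j s t
      using that by (intro cov_family_deriv2[OF SI gI]) simp
    have dC': "((\<lambda>x. cov_family S i b x t) has_real_derivative cov_family S (Suc i) b s t) (at s)" if "i < a" for i s t
      using that by (intro cov_family_deriv1[OF SI gI]) simp
    have eC: ?eC
      by (rule mixed_partial_exists_family[where \<Phi> = "cov_family S", OF lim C0 dC dC'])
    have mC: "mixed_partial ?T a b C s t = cov_family S a b s t" if "s \<in> ?T" "t \<in> ?T" for s t
      by (rule mixed_partial_family[where \<Phi> = "cov_family S", OF lim C0 dC dC' that])
    have eA: ?eA
      by (rule mixed_partial_exists_family[where \<Phi> = "approx_family S L K",
            OF lim approx_cov_eq_family[OF L] approx_family_deriv2 approx_family_deriv1])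
    have mA: "mixed_partial ?T a b (approx_cov S L K) s t = approx_family S L K a b s t"
      if "s \<in> ?T" "t \<in> ?T" for s t
      by (rule mixed_partial_family[where \<Phi> = "approx_family S L K",
            OF lim approx_cov_eq_family[OF L] approx_family_deriv2 approx_family_deriv1 that])
    have "?err s t \<le> ?bd" if st: "s \<in> ?T" "t \<in> ?T" for s t
    proof -
      have "\<bar>s\<bar> \<le> R" "\<bar>t\<bar> \<le> R"
        using subsetD[OF tR st(1)] subsetD[OF tR st(2)] by auto
      then have "\<bar>s - t\<bar> \<le> 2 * R" "\<bar>s + t\<bar> \<le> 2 * R"
        by linarith+
      from expansion_error[OF reg B _ L this, where K = K
          and p = "(real a - real b) * pi / 2" and q = "(real a + real b) * pi / 2"] S0
      show ?thesis
        by (simp add: mC[OF st] mA[OF st] cov_family_def approx_family_eq[OF L] Let_def E_def mult_ac)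
    qed
    with eC eA show ?thesis by blast
  qed
  then show ?eC ?eA "\<And>s t. s \<in> ?T \<Longrightarrow> t \<in> ?T \<Longrightarrow> ?err s t \<le> ?bd" by blast+
qed

section \<open>Vanishing tails, uniform bounds and uniform limits\<close>

text \<open>Dominated convergence with majorant \<open>\<bar>g\<bar>\<close> on the half-line: every
  fixed \<open>w\<close> eventually lies below \<open>X n\<close>.\<close>

lemma tail_integral_tendsto_0:
  fixes g :: "real \<Rightarrow> real"
  assumes g: "set_integrable lborel {0<..} g" and X: "filterlim X at_top sequentially"
  shows "(\<lambda>n. LINT w:{X n..}|lborel. g w) \<longlonglongrightarrow> 0"
proof -
  let ?h = "\<lambda>w. indicator {0<..} w * g w"
  have h: "integrable lborel ?h" using g by (simp add: set_integrable_def)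
  have "(\<lambda>n. \<integral>w. indicator {X n..} w * ?h w \<partial>lborel) \<longlonglongrightarrow> (\<integral>w. 0 \<partial>(lborel :: real measure))"
  proof (rule integral_dominated_convergence[where w = "\<lambda>w. \<bar>?h w\<bar>"])
    show "AE w in lborel. (\<lambda>n. indicator {X n..} w * ?h w) \<longlonglongrightarrow> 0"
    proof (intro AE_I2 tendsto_eventually)
      fix w
      have "eventually (\<lambda>n. X n > w) sequentially"
        using X by (simp add: filterlim_at_top_dense)
      then show "eventually (\<lambda>n. indicator {X n..} w * ?h w = 0) sequentially"
        by eventually_elim auto
    qed
    show "(\<lambda>w. indicator {X n..} w * ?h w) \<in> borel_measurable lborel" for n
      by (intro borel_measurable_times borel_measurable_integrable[OF h]) measurable
    show "AE w in lborel. norm (indicator {X n..} w * ?h w) \<le> \<bar>?h w\<bar>" for n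
      by (auto split: split_indicator)
  qed (use h in auto)
  \<comment> \<open>The integrand was cut off to positive \<open>w\<close>. Once
    \<open>X n > 0\<close>, the ray lies in the half-line and the cut-off has no effect.\<close>
  moreover have "eventually (\<lambda>n. (\<integral>w. indicator {X n..} w * ?h w \<partial>lborel) = (LINT w:{X n..}|lborel. g w)) sequentially"
  proof -
    have "eventually (\<lambda>n. X n > 0) sequentially"
      using X by (simp add: filterlim_at_top_dense)
    then show ?thesis
      by eventually_elim
         (auto simp: set_lebesgue_integral_def intro!: Bochner_Integration.integral_cong split: split_indicator)
  qed
  ultimately show ?thesis
    by (simp add: tendsto_cong)
qed

text \<open>Each \<open>E\<close> is chosen before the interval, \<open>C\<close>, \<open>L\<close>
  and \<open>K\<close>, which expresses its independence of them. Suprema are taken in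
  \<open>ereal\<close>, where they exist without a prior boundedness proof.\<close>

theorem theorem2:
  fixes S :: "real \<Rightarrow> real" and \<Lambda> :: real
  assumes "\<Lambda> > 0"
    and "regular_on_positives S"
  shows
    "(\<exists>E::real. \<forall>(t0::real) (t1::real) (C :: real \<Rightarrow> real \<Rightarrow> real) (L::real) (K::nat).
        t0 \<le> t1 \<and> {t0..t1} \<subseteq> {- \<Lambda>..\<Lambda>} \<and> restricted_stationary_covariance S {t0..t1} C \<and>
        L > \<Lambda> \<and> K \<ge> 1 \<longrightarrow>
        (SUP (s, t) \<in> {t0..t1} \<times> {t0..t1}. ereal \<bar>C s t - approx_cov S L K s t\<bar>)
          \<le> ereal (E / L + 1 / pi * (LINT \<omega>:{pi * real K / (2 * L)..}|lborel. S \<omega>)))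
     \<and>
     (\<forall>(a::nat) (b::nat). regular_on_positives (\<lambda>\<omega>. \<omega> ^ (a + b) * S \<omega>) \<longrightarrow>
      (\<exists>E::real. \<forall>(t0::real) (t1::real) (C :: real \<Rightarrow> real \<Rightarrow> real) (L::real) (K::nat).
        t0 \<le> t1 \<and> {t0..t1} \<subseteq> {- \<Lambda>..\<Lambda>} \<and> restricted_stationary_covariance S {t0..t1} C \<and>
        L > \<Lambda> \<and> K \<ge> 1 \<longrightarrow>
        mixed_partial_exists {t0..t1} a b C \<and>
        mixed_partial_exists {t0..t1} a b (approx_cov S L K) \<and>
        (SUP (s, t) \<in> {t0..t1} \<times> {t0..t1}.
            ereal \<bar>mixed_partial {t0..t1} a b C s t
                     - mixed_partial {t0..t1} a b (approx_cov S L K) s t\<bar>)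
          \<le> ereal (E / L + 1 / pi *
                (LINT \<omega>:{pi * real K / (2 * L)..}|lborel. \<omega> ^ (a + b) * S \<omega>))))
     \<and>
     (\<forall>(t0::real) (t1::real) (C :: real \<Rightarrow> real \<Rightarrow> real) (L :: nat \<Rightarrow> real) (K :: nat \<Rightarrow> nat).
        t0 \<le> t1 \<and> {t0..t1} \<subseteq> {- \<Lambda>..\<Lambda>} \<and> restricted_stationary_covariance S {t0..t1} C \<and>
        filterlim K at_top sequentially \<and> filterlim L at_top sequentially \<and>
        filterlim (\<lambda>n. real (K n) / L n) at_top sequentially \<longrightarrow>
        uniform_limit ({t0..t1} \<times> {t0..t1})
          (\<lambda>n (s, t). approx_cov S (L n) (K n) s t) (\<lambda>(s, t). C s t) sequentially \<and>
        (\<forall>(a::nat) (b::nat). regular_on_positives (\<lambda>\<omega>. \<omega> ^ (a + b) * S \<omega>) \<longrightarrow>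
          uniform_limit ({t0..t1} \<times> {t0..t1})
            (\<lambda>n (s, t). mixed_partial {t0..t1} a b (approx_cov S (L n) (K n)) s t)
            (\<lambda>(s, t). mixed_partial {t0..t1} a b C s t) sequentially))"
    (is "?bound0 \<and> ?bounds \<and> ?limits")
proof -
  \<comment> \<open>\<open>P a b E\<close> states the pointwise bound for all \<open>L > 0\<close>,
    so that one constant serves both the supremum bounds and the limits.\<close>
  define P where "P a b E \<longleftrightarrow> (\<forall>t0 t1 C L K.
      t0 \<le> t1 \<and> {t0..t1} \<subseteq> {- \<Lambda>..\<Lambda>} \<and> restricted_stationary_covariance S {t0..t1} C \<and> L > 0 \<longrightarrow>
      mixed_partial_exists {t0..t1} a b C \<and> mixed_partial_exists {t0..t1} a b (approx_cov S L K) \<and>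
      (\<forall>s\<in>{t0..t1}. \<forall>t\<in>{t0..t1}.
        \<bar>mixed_partial {t0..t1} a b C s t - mixed_partial {t0..t1} a b (approx_cov S L K) s t\<bar>
        \<le> E / L + 1 / pi * (LINT \<omega>:{pi * real K / (2 * L)..}|lborel. \<omega> ^ (a + b) * S \<omega>)))"
    for a b and E :: real
  have ex: "\<exists>E. P a b E" if reg: "regular_on_positives (\<lambda>\<omega>. \<omega> ^ (a + b) * S \<omega>)" for a b
  proof -
    obtain B where "\<And>w. w > 0 \<Longrightarrow> \<bar>w ^ (a + b) * S w\<bar> \<le> B"
      using reg unfolding regular_on_positives_def bounded_iff by auto
    note err = mixed_partial_error[OF assms(2) reg this assms(1)]
    show ?thesis
      unfolding P_def by (rule exI, intro allI impI conjI ballI; elim conjE; rule err; assumption)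
  qed
  \<comment> \<open>Choice fixes one constant per pair; it is meaningful for those pairs whose
    weighted density is regular.\<close>
  define E where "E a b = (SOME e. P a b e)" for a b
  have E: "mixed_partial_exists {t0..t1} a b C \<and> mixed_partial_exists {t0..t1} a b (approx_cov S L K) \<and>
      (\<forall>s\<in>{t0..t1}. \<forall>t\<in>{t0..t1}.
        \<bar>mixed_partial {t0..t1} a b C s t - mixed_partial {t0..t1} a b (approx_cov S L K) s t\<bar>
        \<le> E a b / L + 1 / pi * (LINT \<omega>:{pi * real K / (2 * L)..}|lborel. \<omega> ^ (a + b) * S \<omega>))"
    if "regular_on_positives (\<lambda>\<omega>. \<omega> ^ (a + b) * S \<omega>)" "t0 \<le> t1" "{t0..t1} \<subseteq> {- \<Lambda>..\<Lambda>}"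
      "restricted_stationary_covariance S {t0..t1} C" "L > 0" for a b t0 t1 C L K
  proof -
    have "P a b (E a b)"
      unfolding E_def by (rule someI_ex[OF ex[OF that(1)]])
    then show ?thesis
      unfolding P_def by (elim allE impE) (use that in blast)+
  qed
  have bounds: ?bounds
  proof (intro allI impI, rule exI, intro allI impI, elim conjE, intro conjI)
    fix a b t0 t1 C L and K :: nat
    assume *: "regular_on_positives (\<lambda>\<omega>. \<omega> ^ (a + b) * S \<omega>)" "t0 \<le> t1" "{t0..t1} \<subseteq> {- \<Lambda>..\<Lambda>}"
      "restricted_stationary_covariance S {t0..t1} C" "L > \<Lambda>"
    then have "L > 0" using assms(1) by simp
    note EE = E[OF *(1-4) this, of K]
    show "mixed_partial_exists {t0..t1} a b C" "mixed_partial_exists {t0..t1} a b (approx_cov S L K)"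
      using EE by auto
    show "(SUP (s, t) \<in> {t0..t1} \<times> {t0..t1}. ereal \<bar>mixed_partial {t0..t1} a b C s t
        - mixed_partial {t0..t1} a b (approx_cov S L K) s t\<bar>)
      \<le> ereal (E a b / L + 1 / pi * (LINT \<omega>:{pi * real K / (2 * L)..}|lborel. \<omega> ^ (a + b) * S \<omega>))"
      using EE by (intro SUP_least) auto
  qed
  have reg00: "regular_on_positives (\<lambda>\<omega>. \<omega> ^ (0 + 0) * S \<omega>)"
    using assms(2) by simp
  \<comment> \<open>The undifferentiated bound is the case \<open>a = b = 0\<close>, with weight
    \<open>\<omega> ^ 0 = 1\<close>.\<close>
  have bound0: ?bound0
    using bounds[rule_format, OF reg00] by (rule ex_forward) auto
  have lim: "uniform_limit ({t0..t1} \<times> {t0..t1})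
      (\<lambda>n (s, t). mixed_partial {t0..t1} a b (approx_cov S (L n) (K n)) s t)
      (\<lambda>(s, t). mixed_partial {t0..t1} a b C s t) sequentially"
    if reg: "regular_on_positives (\<lambda>\<omega>. \<omega> ^ (a + b) * S \<omega>)"
      and *: "t0 \<le> t1" "{t0..t1} \<subseteq> {- \<Lambda>..\<Lambda>}" "restricted_stationary_covariance S {t0..t1} C"
      and L: "filterlim L at_top sequentially"
      and KL: "filterlim (\<lambda>n. real (K n) / L n) at_top sequentially"
    for a b t0 t1 C L and K :: "nat \<Rightarrow> nat"
  proof -
    let ?g = "\<lambda>\<omega>. \<omega> ^ (a + b) * S \<omega>"
    let ?bd = "\<lambda>n. E a b / L n + 1 / pi * (LINT \<omega>:{pi * real (K n) / (2 * L n)..}|lborel. ?g \<omega>)"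
    \<comment> \<open>The cutoff frequency is a positive constant times \<open>K / L\<close>, so it
      tends to infinity and the tail vanishes.\<close>
    have "filterlim (\<lambda>n. pi / 2 * (real (K n) / L n)) at_top sequentially"
      by (rule filterlim_tendsto_pos_mult_at_top[OF tendsto_const _ KL]) simp
    then have "filterlim (\<lambda>n. pi * real (K n) / (2 * L n)) at_top sequentially"
      by (simp add: mult.commute)
    then have "?bd \<longlonglongrightarrow> 0 + 1 / pi * 0"
      using reg
      by (intro tendsto_add tendsto_mult tendsto_const tail_integral_tendsto_0
          tendsto_divide_0[OF tendsto_const] filterlim_at_top_imp_at_infinity[OF L])
         (auto simp: regular_on_positives_def)
    then have bd: "?bd \<longlonglongrightarrow> 0" by simp
    show ?thesis
    proof (rule uniform_limitI)
      fix e :: real assume "e > 0"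
      with bd have "eventually (\<lambda>n. ?bd n < e) sequentially"
        by (rule order_tendstoD)
      \<comment> \<open>Finitely many \<open>L n\<close> may be nonpositive; the error bound is used
        from the point where they are positive.\<close>
      moreover have "eventually (\<lambda>n. L n > 0) sequentially"
        using L by (simp add: filterlim_at_top_dense)
      ultimately show "eventually (\<lambda>n. \<forall>x\<in>{t0..t1} \<times> {t0..t1}.
          dist (case x of (s, t) \<Rightarrow> mixed_partial {t0..t1} a b (approx_cov S (L n) (K n)) s t)
            (case x of (s, t) \<Rightarrow> mixed_partial {t0..t1} a b C s t) < e) sequentially"
      proof eventually_elim
        case (elim n)
        have "\<bar>mixed_partial {t0..t1} a b C s t - mixed_partial {t0..t1} a b (approx_cov S (L n) (K n)) s t\<bar> < e"
          if "s \<in> {t0..t1}" "t \<in> {t0..t1}" for s t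
          using E[OF reg * elim(2), of "K n"] that elim(1) by (meson le_less_trans)
        then show ?case
          by (auto simp: dist_real_def abs_minus_commute)
      qed
    qed
  qed
  have limits: ?limits
  proof (intro allI impI conjI; elim conjE)
    fix t0 t1 C L and K :: "nat \<Rightarrow> nat"
    assume *: "t0 \<le> t1" "{t0..t1} \<subseteq> {- \<Lambda>..\<Lambda>}" "restricted_stationary_covariance S {t0..t1} C"
      "filterlim L at_top sequentially" "filterlim (\<lambda>n. real (K n) / L n) at_top sequentially"
    show "uniform_limit ({t0..t1} \<times> {t0..t1})
        (\<lambda>n (s, t). approx_cov S (L n) (K n) s t) (\<lambda>(s, t). C s t) sequentially"
      using lim[OF reg00 *] by simp
    show "uniform_limit ({t0..t1} \<times> {t0..t1})
        (\<lambda>n (s, t). mixed_partial {t0..t1} a b (approx_cov S (L n) (K n)) s t)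
        (\<lambda>(s, t). mixed_partial {t0..t1} a b C s t) sequentially"
      if "regular_on_positives (\<lambda>\<omega>. \<omega> ^ (a + b) * S \<omega>)" for a b
      using lim[OF that *] .
  qed
  show ?thesis
    using bound0 bounds limits by (intro conjI)
qed

end
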